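(* Let $T_0$ be a consistent theory in a signature $\Sigma(T_0)$, let $C$ be a set of new constant symbols, and let $T\supseteq T_0$ be a complete theory in the signature $\Sigma(T_0)\cup C$ such that whenever $\exists y\,\varphi(y)\in T$ there is $c\in C$ with $\varphi(c)\in T$. Let $\mathcal{M}_0\models T_0$ and let $\mathcal{M}$ be an expansion of $\mathcal{M}_0$ to the signature $\Sigma(T_0)\cup C$ in which every element is named by infinitely many constants of $C$. Then the following conditions are equivalent: (1) $\mathcal{M}$ satisfies the preserving condition (relative to $T$); (2) the restriction $\mathcal{M}\upharpoonright\Sigma(T_0)$ satisfies the preserving condition (relative to $T$); (3) $\mathcal{M}$ is a canonical model of the completion $T$ of $T_0$.
   Context: For $c\in C$ let $[c]$ denote the element of $\mathcal{M}$ named by $c$; $M$ is the common universe of $\mathcal{M}$ and $\mathcal{M}\upharpoonright\Sigma(T_0)$. Preserving condition (relative to $T$), for $\mathcal{N}=\mathcal{M}$ or $\mathcal{N}=\mathcal{M}\upharpoonright\Sigma(T_0)$: for every $\Sigma(T_0)$-formula $\varphi(x_1,\ldots,x_n,x)$ and all $c_1,\ldots,c_n\in C$, if $\exists x\,\varphi(c_1,\ldots,c_n,x)\in T$ then $\varphi(x_1,\ldots,x_n,x)$ is $\exists$-partially $(\{[c_1]\},\ldots,\{[c_n]\},M)$-preserving in $\mathcal{N}$, i.e. $\varphi([c_1],\ldots,[c_n],\mathcal{N})\cap M\neq\emptyset$, where $\varphi(a_1,\ldots,a_n,\mathcal{N})=\{b\in M\mid\mathcal{N}\models\varphi(a_1,\ldots,a_n,b)\}$.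 Canonical model of $T$: the structure whose elements are the equivalence classes $\{c'\in C\mid (c'\approx c)\in T\}$, $c\in C$ (all of them infinite), where each constant symbol is interpreted by its own class, $f([c_1],\ldots,[c_n])=[c]$ iff $(f(c_1,\ldots,c_n)\approx c)\in T$ for each functional symbol $f\in\Sigma(T_0)$, and $R([c_1],\ldots,[c_n])$ holds iff $R(c_1,\ldots,c_n)\in T$ for each relational symbol $R\in\Sigma(T_0)$. The structure $\mathcal{M}$ is said to be a canonical model of $T$ if it is this structure after identifying the element named by $c$ with the class of $c$. *)

theory Defs imports Main begin

section \<open>First-order syntax\<close>

text \<open>Constant symbols are function symbols of arity 0.\<close>

record ('f, 'r) signature =
  funs :: "'f set"
  far :: "'f \<Rightarrow> nat"
  rels :: "'r set"
  rar :: "'r \<Rightarrow> nat"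

datatype 'f trm = Var nat | Fun 'f "'f trm list"

abbreviation Const :: "'f \<Rightarrow> 'f trm" where
  "Const c \<equiv> Fun c []"

text \<open>The remaining connectives and the universal quantifier are definable.\<close>

datatype ('f, 'r) fm =
    Eq "'f trm" "'f trm"
  | Rel 'r "'f trm list"
  | Neg "('f, 'r) fm"
  | Conj "('f, 'r) fm" "('f, 'r) fm"
  | Ex nat "('f, 'r) fm"

primrec is_trm :: "('f, 'r) signature \<Rightarrow> 'f trm \<Rightarrow> bool" where
  "is_trm \<Sigma> (Var v) \<longleftrightarrow> True"
| "is_trm \<Sigma> (Fun f ts) \<longleftrightarrow> f \<in> funs \<Sigma> \<and> length ts = far \<Sigma> f \<and> list_all (is_trm \<Sigma>) ts"

primrec is_fm :: "('f, 'r) signature \<Rightarrow> ('f, 'r) fm \<Rightarrow> bool" where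
  "is_fm \<Sigma> (Eq s t) \<longleftrightarrow> is_trm \<Sigma> s \<and> is_trm \<Sigma> t"
| "is_fm \<Sigma> (Rel R ts) \<longleftrightarrow> R \<in> rels \<Sigma> \<and> length ts = rar \<Sigma> R \<and> list_all (is_trm \<Sigma>) ts"
| "is_fm \<Sigma> (Neg \<phi>) \<longleftrightarrow> is_fm \<Sigma> \<phi>"
| "is_fm \<Sigma> (Conj \<phi> \<psi>) \<longleftrightarrow> is_fm \<Sigma> \<phi> \<and> is_fm \<Sigma> \<psi>"
| "is_fm \<Sigma> (Ex x \<phi>) \<longleftrightarrow> is_fm \<Sigma> \<phi>"

primrec fvt :: "'f trm \<Rightarrow> nat set" where
  "fvt (Var v) = {v}"
| "fvt (Fun f ts) = \<Union> (set (map fvt ts))"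

primrec fv :: "('f, 'r) fm \<Rightarrow> nat set" where
  "fv (Eq s t) = fvt s \<union> fvt t"
| "fv (Rel R ts) = \<Union> (set (map fvt ts))"
| "fv (Neg \<phi>) = fv \<phi>"
| "fv (Conj \<phi> \<psi>) = fv \<phi> \<union> fv \<psi>"
| "fv (Ex x \<phi>) = fv \<phi> - {x}"

definition is_sentence :: "('f, 'r) signature \<Rightarrow> ('f, 'r) fm \<Rightarrow> bool" where
  "is_sentence \<Sigma> \<phi> \<longleftrightarrow> is_fm \<Sigma> \<phi> \<and> fv \<phi> = {}"

primrec substt :: "(nat \<Rightarrow> 'f trm) \<Rightarrow> 'f trm \<Rightarrow> 'f trm" where
  "substt \<sigma> (Var v) = \<sigma> v"
| "substt \<sigma> (Fun f ts) = Fun f (map (substt \<sigma>) ts)"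

text \<open>
  Simultaneous substitution for the free variables.  Bound variables are not renamed: substituting
  closed terms is always correct, other uses need the side condition \<open>free_for\<close> below.
\<close>

primrec subst :: "(nat \<Rightarrow> 'f trm) \<Rightarrow> ('f, 'r) fm \<Rightarrow> ('f, 'r) fm" where
  "subst \<sigma> (Eq s t) = Eq (substt \<sigma> s) (substt \<sigma> t)"
| "subst \<sigma> (Rel R ts) = Rel R (map (substt \<sigma>) ts)"
| "subst \<sigma> (Neg \<phi>) = Neg (subst \<sigma> \<phi>)"
| "subst \<sigma> (Conj \<phi> \<psi>) = Conj (subst \<sigma> \<phi>) (subst \<sigma> \<psi>)"
| "subst \<sigma> (Ex x \<phi>) = Ex x (subst (\<sigma>(x := Var x)) \<phi>)"

definition subst1 :: "nat \<Rightarrow> 'f trm \<Rightarrow> ('f, 'r) fm \<Rightarrow> ('f, 'r) fm" where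
  "subst1 x t = subst (Var(x := t))"

definition subst_consts :: "nat list \<Rightarrow> 'f list \<Rightarrow> ('f, 'r) fm \<Rightarrow> ('f, 'r) fm" where
  "subst_consts xs cs =
    subst (\<lambda>v. case map_of (zip xs cs) v of Some c \<Rightarrow> Const c | None \<Rightarrow> Var v)"

primrec free_for :: "'f trm \<Rightarrow> nat \<Rightarrow> ('f, 'r) fm \<Rightarrow> bool" where
  "free_for t x (Eq s s') \<longleftrightarrow> True"
| "free_for t x (Rel R ts) \<longleftrightarrow> True"
| "free_for t x (Neg \<phi>) \<longleftrightarrow> free_for t x \<phi>"
| "free_for t x (Conj \<phi> \<psi>) \<longleftrightarrow> free_for t x \<phi> \<and> free_for t x \<psi>"
| "free_for t x (Ex y \<phi>) \<longleftrightarrow> x \<notin> fv \<phi> - {y} \<or> (y \<notin> fvt t \<and> free_for t x \<phi>)"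

section \<open>Deduction and theories\<close>

text \<open>Classical natural deduction with equality, using formulas of the signature \<open>\<Sigma>\<close> only.\<close>

inductive provable :: "('f, 'r) signature \<Rightarrow> ('f, 'r) fm set \<Rightarrow> ('f, 'r) fm \<Rightarrow> bool"
  for \<Sigma> :: "('f, 'r) signature" where
  assm: "\<phi> \<in> \<Gamma> \<Longrightarrow> is_fm \<Sigma> \<phi> \<Longrightarrow> provable \<Sigma> \<Gamma> \<phi>"
| negI: "is_fm \<Sigma> \<phi> \<Longrightarrow> provable \<Sigma> (insert \<phi> \<Gamma>) \<psi> \<Longrightarrow> provable \<Sigma> (insert \<phi> \<Gamma>) (Neg \<psi>)
    \<Longrightarrow> provable \<Sigma> \<Gamma> (Neg \<phi>)"
| contr: "is_fm \<Sigma> \<phi> \<Longrightarrow> provable \<Sigma> (insert (Neg \<phi>) \<Gamma>) \<psi>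
    \<Longrightarrow> provable \<Sigma> (insert (Neg \<phi>) \<Gamma>) (Neg \<psi>) \<Longrightarrow> provable \<Sigma> \<Gamma> \<phi>"
| conjI: "provable \<Sigma> \<Gamma> \<phi> \<Longrightarrow> provable \<Sigma> \<Gamma> \<psi> \<Longrightarrow> provable \<Sigma> \<Gamma> (Conj \<phi> \<psi>)"
| conjE1: "provable \<Sigma> \<Gamma> (Conj \<phi> \<psi>) \<Longrightarrow> provable \<Sigma> \<Gamma> \<phi>"
| conjE2: "provable \<Sigma> \<Gamma> (Conj \<phi> \<psi>) \<Longrightarrow> provable \<Sigma> \<Gamma> \<psi>"
| exI: "is_fm \<Sigma> \<phi> \<Longrightarrow> is_trm \<Sigma> t \<Longrightarrow> free_for t x \<phi> \<Longrightarrow> provable \<Sigma> \<Gamma> (subst1 x t \<phi>)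
    \<Longrightarrow> provable \<Sigma> \<Gamma> (Ex x \<phi>)"
| exE: "provable \<Sigma> \<Gamma> (Ex x \<phi>) \<Longrightarrow> provable \<Sigma> (insert \<phi> \<Gamma>) \<psi> \<Longrightarrow> x \<notin> fv \<psi>
    \<Longrightarrow> \<forall>\<gamma>\<in>\<Gamma>. x \<notin> fv \<gamma> \<Longrightarrow> provable \<Sigma> \<Gamma> \<psi>"
| refl: "is_trm \<Sigma> t \<Longrightarrow> provable \<Sigma> \<Gamma> (Eq t t)"
| repl: "is_fm \<Sigma> \<phi> \<Longrightarrow> free_for s x \<phi> \<Longrightarrow> free_for t x \<phi> \<Longrightarrow> provable \<Sigma> \<Gamma> (Eq s t)
    \<Longrightarrow> provable \<Sigma> \<Gamma> (subst1 x s \<phi>) \<Longrightarrow> provable \<Sigma> \<Gamma> (subst1 x t \<phi>)"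

definition is_theory :: "('f, 'r) signature \<Rightarrow> ('f, 'r) fm set \<Rightarrow> bool" where
  "is_theory \<Sigma> T \<longleftrightarrow> (\<forall>\<phi>\<in>T. is_sentence \<Sigma> \<phi>)"

definition consistent :: "('f, 'r) signature \<Rightarrow> ('f, 'r) fm set \<Rightarrow> bool" where
  "consistent \<Sigma> T \<longleftrightarrow> \<not> (\<exists>\<phi>. provable \<Sigma> T \<phi> \<and> provable \<Sigma> T (Neg \<phi>))"

text \<open>
  Theories are not required to be deductively closed, but a complete theory is, since it is
  consistent and \<^emph>\<open>contains\<close> each sentence or its negation.
\<close>

definition complete_theory :: "('f, 'r) signature \<Rightarrow> ('f, 'r) fm set \<Rightarrow> bool" where
  "complete_theory \<Sigma> T \<longleftrightarrow>
    is_theory \<Sigma> T \<and> consistent \<Sigma> T \<and> (\<forall>\<phi>. is_sentence \<Sigma> \<phi> \<longrightarrow> \<phi> \<in> T \<or> Neg \<phi> \<in> T)"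

definition add_consts :: "('f, 'r) signature \<Rightarrow> 'f set \<Rightarrow> ('f, 'r) signature" where
  "add_consts \<Sigma> C = \<Sigma>\<lparr>funs := funs \<Sigma> \<union> C, far := (\<lambda>f. if f \<in> C then 0 else far \<Sigma> f)\<rparr>"

definition has_witnesses :: "'f set \<Rightarrow> ('f, 'r) fm set \<Rightarrow> bool" where
  "has_witnesses C T \<longleftrightarrow> (\<forall>y \<phi>. Ex y \<phi> \<in> T \<longrightarrow> (\<exists>c\<in>C. subst1 y (Const c) \<phi> \<in> T))"

section \<open>Structures\<close>

text \<open>
  The interpretation functions are total; only their values at symbols of the signature and at
  argument lists of the right length from the universe are meaningful.
\<close>

record ('f, 'r, 'a) struct =
  univ :: "'a set"
  funI :: "'f \<Rightarrow> 'a list \<Rightarrow> 'a"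
  relI :: "'r \<Rightarrow> 'a list \<Rightarrow> bool"

definition is_struct :: "('f, 'r) signature \<Rightarrow> ('f, 'r, 'a) struct \<Rightarrow> bool" where
  "is_struct \<Sigma> M \<longleftrightarrow> univ M \<noteq> {} \<and>
    (\<forall>f\<in>funs \<Sigma>. \<forall>as\<in>lists (univ M). length as = far \<Sigma> f \<longrightarrow> funI M f as \<in> univ M)"

primrec eval_trm :: "('f, 'r, 'a) struct \<Rightarrow> (nat \<Rightarrow> 'a) \<Rightarrow> 'f trm \<Rightarrow> 'a" where
  "eval_trm M e (Var v) = e v"
| "eval_trm M e (Fun f ts) = funI M f (map (eval_trm M e) ts)"

primrec sat :: "('f, 'r, 'a) struct \<Rightarrow> (nat \<Rightarrow> 'a) \<Rightarrow> ('f, 'r) fm \<Rightarrow> bool" where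
  "sat M e (Eq s t) \<longleftrightarrow> eval_trm M e s = eval_trm M e t"
| "sat M e (Rel R ts) \<longleftrightarrow> relI M R (map (eval_trm M e) ts)"
| "sat M e (Neg \<phi>) \<longleftrightarrow> \<not> sat M e \<phi>"
| "sat M e (Conj \<phi> \<psi>) \<longleftrightarrow> sat M e \<phi> \<and> sat M e \<psi>"
| "sat M e (Ex x \<phi>) \<longleftrightarrow> (\<exists>a\<in>univ M. sat M (e(x := a)) \<phi>)"

definition is_model ::
  "('f, 'r) signature \<Rightarrow> ('f, 'r, 'a) struct \<Rightarrow> ('f, 'r) fm set \<Rightarrow> bool" where
  "is_model \<Sigma> M T \<longleftrightarrow> is_struct \<Sigma> M \<and>
    (\<forall>\<phi>\<in>T. \<forall>e. (\<forall>v. e v \<in> univ M) \<longrightarrow> sat M e \<phi>)"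

definition reduct ::
  "('f, 'r, 'a) struct \<Rightarrow> ('f, 'r) signature \<Rightarrow> ('f, 'r, 'a) struct" where
  "reduct M \<Sigma> = \<lparr>univ = univ M,
     funI = (\<lambda>f. if f \<in> funs \<Sigma> then funI M f else undefined),
     relI = (\<lambda>R. if R \<in> rels \<Sigma> then relI M R else undefined)\<rparr>"

text \<open>\<open>M\<close> is an expansion of the \<open>\<Sigma>\<close>-structure \<open>M0\<close> to the signature \<open>\<Sigma>'\<close>.\<close>

definition is_expansion :: "('f, 'r) signature \<Rightarrow> ('f, 'r, 'a) struct
    \<Rightarrow> ('f, 'r) signature \<Rightarrow> ('f, 'r, 'a) struct \<Rightarrow> bool" where
  "is_expansion \<Sigma> M0 \<Sigma>' M \<longleftrightarrow> is_struct \<Sigma>' M \<and> univ M = univ M0 \<and>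
    (\<forall>f\<in>funs \<Sigma>. \<forall>as\<in>lists (univ M). length as = far \<Sigma> f \<longrightarrow> funI M f as = funI M0 f as) \<and>
    (\<forall>R\<in>rels \<Sigma>. \<forall>as\<in>lists (univ M). length as = rar \<Sigma> R \<longrightarrow> relI M R as = relI M0 R as)"

definition is_isomorphism :: "('f, 'r) signature \<Rightarrow> ('a \<Rightarrow> 'b) \<Rightarrow> ('f, 'r, 'a) struct
    \<Rightarrow> ('f, 'r, 'b) struct \<Rightarrow> bool" where
  "is_isomorphism \<Sigma> h M N \<longleftrightarrow> bij_betw h (univ M) (univ N) \<and>
    (\<forall>f\<in>funs \<Sigma>. \<forall>as\<in>lists (univ M). length as = far \<Sigma> f \<longrightarrow>
       h (funI M f as) = funI N f (map h as)) \<and>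
    (\<forall>R\<in>rels \<Sigma>. \<forall>as\<in>lists (univ M). length as = rar \<Sigma> R \<longrightarrow>
       relI M R as = relI N R (map h as))"

text \<open>\<open>named M c\<close> is the element \<open>[c]\<close>.\<close>

definition named :: "('f, 'r, 'a) struct \<Rightarrow> 'f \<Rightarrow> 'a" where
  "named M c = funI M c []"

section \<open>The preserving condition\<close>

text \<open>
  \<open>solutions N \<phi> xs as\<close> is \<open>\<phi>(a\<^sub>1, \<dots>, a\<^sub>n, N)\<close>, where \<open>xs\<close> are the parameter
  variables \<open>x\<^sub>1, \<dots>, x\<^sub>n\<close>.  All variables outside \<open>xs\<close> are assigned \<open>b\<close>; in the intended use \<open>\<phi>\<close>
  has exactly one such variable available as a free variable.
\<close>

definition solutions ::
  "('f, 'r, 'a) struct \<Rightarrow> ('f, 'r) fm \<Rightarrow> nat list \<Rightarrow> 'a list \<Rightarrow> 'a set" where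
  "solutions N \<phi> xs as =
    {b \<in> univ N. sat N (\<lambda>v. case map_of (zip xs as) v of Some a \<Rightarrow> a | None \<Rightarrow> b) \<phi>}"

text \<open>
  \<open>\<phi>\<close> is \<open>\<exists>\<close>-partially \<open>({a\<^sub>1}, \<dots>, {a\<^sub>n}, Y)\<close>-preserving in \<open>N\<close>; only singletons occur
  in the first \<open>n\<close> places, so they are given by their elements.
\<close>

definition ex_partially_preserving ::
  "('f, 'r, 'a) struct \<Rightarrow> ('f, 'r) fm \<Rightarrow> nat list \<Rightarrow> 'a list \<Rightarrow> 'a set \<Rightarrow> bool" where
  "ex_partially_preserving N \<phi> xs as Y \<longleftrightarrow> solutions N \<phi> xs as \<inter> Y \<noteq> {}"

text \<open>
  \<open>\<Sigma>\<close> is the signature without the constants \<open>C\<close>.  The structure \<open>M\<close> provides the elements \<open>[c]\<close>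
  and the universe, \<open>N\<close> is the structure in which formulas are evaluated (\<open>M\<close> or its reduct).
\<close>

definition preserving_condition :: "('f, 'r) signature \<Rightarrow> 'f set \<Rightarrow> ('f, 'r) fm set
    \<Rightarrow> ('f, 'r, 'a) struct \<Rightarrow> ('f, 'r, 'a) struct \<Rightarrow> bool" where
  "preserving_condition \<Sigma> C T M N \<longleftrightarrow>
    (\<forall>\<phi> xs x cs. is_fm \<Sigma> \<phi> \<longrightarrow> distinct (xs @ [x]) \<longrightarrow> fv \<phi> \<subseteq> set (xs @ [x]) \<longrightarrow>
       length cs = length xs \<longrightarrow> set cs \<subseteq> C \<longrightarrow>
       Ex x (subst_consts xs cs \<phi>) \<in> T \<longrightarrow>
       ex_partially_preserving N \<phi> xs (map (named M) cs) (univ M))"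

section \<open>Canonical models\<close>

definition const_class :: "'f set \<Rightarrow> ('f, 'r) fm set \<Rightarrow> 'f \<Rightarrow> 'f set" where
  "const_class C T c = {c' \<in> C. Eq (Const c') (Const c) \<in> T}"

definition canonical_struct :: "'f set \<Rightarrow> ('f, 'r) fm set \<Rightarrow> ('f, 'r, 'f set) struct" where
  "canonical_struct C T =
    \<lparr>univ = const_class C T ` C,
     funI = (\<lambda>f as. if f \<in> C then const_class C T f else
       (THE a. \<exists>cs c. set cs \<subseteq> C \<and> c \<in> C \<and> as = map (const_class C T) cs \<and>
          a = const_class C T c \<and> Eq (Fun f (map Const cs)) (Const c) \<in> T)),
     relI = (\<lambda>R as. \<exists>cs. set cs \<subseteq> C \<and> as = map (const_class C T) cs \<and>
       Rel R (map Const cs) \<in> T)\<rparr>"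

text \<open>
  An isomorphism of structures in the signature with \<open>C\<close> sends the element named by \<open>c\<close> to the
  class of \<open>c\<close>, so it is the identification of \<open>[c]\<close> with that class.
\<close>

definition is_canonical_model :: "('f, 'r) signature \<Rightarrow> 'f set \<Rightarrow> ('f, 'r) fm set
    \<Rightarrow> ('f, 'r, 'a) struct \<Rightarrow> bool" where
  "is_canonical_model \<Sigma> C T M \<longleftrightarrow>
    (\<forall>c\<in>C. infinite (const_class C T c)) \<and>
    (\<exists>h. is_isomorphism (add_consts \<Sigma> C) h M (canonical_struct C T))"

end

theory Submission imports Defs begin

text \<open>
  Preservation of \<open>\<phi>(c\<^sub>1, \<dots>, c\<^sub>n, x)\<close> with a dummy variable \<open>x\<close> says that the \<open>\<Sigma>\<close>-formula
  \<open>\<phi>\<close> holds at \<open>[c\<^sub>1], \<dots>, [c\<^sub>n]\<close> as soon as \<open>\<phi>(c\<^sub>1, \<dots>, c\<^sub>n) \<in> T\<close>; applied to negations,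
  completeness of \<open>T\<close> turns this into an equivalence.  For atomic formulas the equivalence is
  exactly the statement that \<open>[c]\<close> corresponds to the class of \<open>c\<close> isomorphically.
  Conversely, the usual Henkin truth lemma extends the equivalence from atomic formulas to all
  \<open>\<Sigma>\<close>-formulas, and the witness of an existential sentence in \<open>T\<close> then names a solution in \<open>M\<close>.
\<close>

section \<open>Substitution and evaluation\<close>

lemma substt_cong: "(\<And>v. v \<in> fvt t \<Longrightarrow> \<sigma> v = \<tau> v) \<Longrightarrow> substt \<sigma> t = substt \<tau> t"
  by (induction t) auto

lemma subst_cong: "(\<And>v. v \<in> fv \<phi> \<Longrightarrow> \<sigma> v = \<tau> v) \<Longrightarrow> subst \<sigma> \<phi> = subst \<tau> \<phi>"
proof (induction \<phi> arbitrary: \<sigma> \<tau>)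
  case (Eq s t)
  have "substt \<sigma> s = substt \<tau> s" "substt \<sigma> t = substt \<tau> t"
    using Eq by (auto intro!: substt_cong)
  then show ?case by simp
next
  case (Rel R ts)
  have "substt \<sigma> t = substt \<tau> t" if "t \<in> set ts" for t
    using Rel that by (intro substt_cong) auto
  then show ?case by simp
next
  case (Ex x \<phi>)
  show ?case using Ex.prems by (auto intro!: Ex.IH)
next
  case (Conj \<phi> \<psi>)
  have "subst \<sigma> \<phi> = subst \<tau> \<phi>" "subst \<sigma> \<psi> = subst \<tau> \<psi>"
    using Conj.prems by (intro Conj.IH; simp)+
  then show ?case by simp
next
  case (Neg \<phi>)
  have "subst \<sigma> \<phi> = subst \<tau> \<phi>"
    using Neg.prems by (intro Neg.IH) simp
  then show ?case by simp
qed

lemma substt_Var [simp]: "substt Var t = t"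
  by (induction t) (auto simp: map_idI)

lemma subst_Var [simp]: "subst Var \<phi> = \<phi>"
  by (induction \<phi>) (auto simp: map_idI)

lemma substt_closed: "fvt t = {} \<Longrightarrow> substt \<sigma> t = t"
  by (metis empty_iff substt_Var substt_cong)

lemma substt_substt: "substt \<tau> (substt \<sigma> t) = substt (\<lambda>v. substt \<tau> (\<sigma> v)) t"
  by (induction t) auto

text \<open>Bound variables are not renamed, so composition can fail: if \<open>\<sigma> v\<close>
  is a different variable \<open>x\<close> and \<open>v\<close> occurs below a quantifier over
  \<open>x\<close>, the outer substitution skips that \<open>x\<close>. When each
  \<open>\<sigma> v\<close> is closed or \<open>Var v\<close> this cannot happen: below
  \<open>Ex x\<close> a closed value ignores the outer substitution, and a variable other than
  \<open>x\<close> still receives its \<open>\<tau>\<close>-value.\<close>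

lemma subst_subst:
  assumes "\<And>v. fvt (\<sigma> v) = {} \<or> \<sigma> v = Var v"
  shows "subst \<tau> (subst \<sigma> \<phi>) = subst (\<lambda>v. substt \<tau> (\<sigma> v)) \<phi>"
  using assms
proof (induction \<phi> arbitrary: \<sigma> \<tau>)
  case (Ex x \<phi>)
  have "subst (\<tau>(x := Var x)) (subst (\<sigma>(x := Var x)) \<phi>)
      = subst (\<lambda>v. substt (\<tau>(x := Var x)) ((\<sigma>(x := Var x)) v)) \<phi>"
    using Ex.prems by (intro Ex.IH) auto
  also have "(\<lambda>v. substt (\<tau>(x := Var x)) ((\<sigma>(x := Var x)) v))
      = (\<lambda>v. substt \<tau> (\<sigma> v))(x := Var x)"
  proof
    fix v
    show "substt (\<tau>(x := Var x)) ((\<sigma>(x := Var x)) v) = ((\<lambda>v. substt \<tau> (\<sigma> v))(x := Var x)) v"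
      using Ex.prems[of v] by (auto simp: substt_closed)
  qed
  finally show ?case by (simp only: subst.simps)
qed (auto simp: substt_substt)

lemma is_trm_substt: "is_trm \<Sigma> t \<Longrightarrow> (\<And>v. is_trm \<Sigma> (\<sigma> v)) \<Longrightarrow> is_trm \<Sigma> (substt \<sigma> t)"
  by (induction t) (auto simp: list_all_iff)

lemma is_fm_subst: "is_fm \<Sigma> \<phi> \<Longrightarrow> (\<And>v. is_trm \<Sigma> (\<sigma> v)) \<Longrightarrow> is_fm \<Sigma> (subst \<sigma> \<phi>)"
proof (induction \<phi> arbitrary: \<sigma>)
  case (Ex x \<phi>)
  then show ?case by auto
qed (auto simp: list_all_iff is_trm_substt)

lemma fvt_substt: "fvt (substt \<sigma> t) = (\<Union>v\<in>fvt t. fvt (\<sigma> v))"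
  by (induction t) auto

text \<open>Only an inclusion, because a variable of \<open>\<sigma> v\<close> may become bound when
  it is inserted below a quantifier.\<close>

lemma fv_subst_subset: "fv (subst \<sigma> \<phi>) \<subseteq> (\<Union>v\<in>fv \<phi>. fvt (\<sigma> v))"
proof (induction \<phi> arbitrary: \<sigma>)
  case (Ex x \<phi>)
  show ?case
  proof
    fix w assume "w \<in> fv (subst \<sigma> (Ex x \<phi>))"
    then have w: "w \<in> fv (subst (\<sigma>(x := Var x)) \<phi>)" "w \<noteq> x" by auto
    then obtain v where "v \<in> fv \<phi>" "w \<in> fvt ((\<sigma>(x := Var x)) v)"
      using Ex.IH[of "\<sigma>(x := Var x)"] by blast
    then show "w \<in> (\<Union>v\<in>fv (Ex x \<phi>). fvt (\<sigma> v))"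
      using w(2) by (cases "v = x") auto
  qed
next
  case (Conj \<phi> \<psi>)
  show ?case using Conj.IH[of \<sigma>] by auto
next
  case (Neg \<phi>)
  show ?case using Neg.IH[of \<sigma>] by simp
qed (auto simp: fvt_substt)

lemma fv_subst_subsetI:
  assumes "\<And>v. v \<in> fv \<phi> \<Longrightarrow> fvt (\<sigma> v) \<subseteq> A"
  shows "fv (subst \<sigma> \<phi>) \<subseteq> A"
proof -
  have "(\<Union>v\<in>fv \<phi>. fvt (\<sigma> v)) \<subseteq> A" using assms by (rule UN_least)
  with fv_subst_subset show ?thesis by (rule subset_trans)
qed

lemma free_for_closed: "fvt t = {} \<Longrightarrow> free_for t x \<phi>"
  by (induction \<phi>) auto

lemma free_for_nonfree: "x \<notin> fv \<phi> \<Longrightarrow> free_for t x \<phi>"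
  by (induction \<phi>) auto

lemma finite_fvt: "finite (fvt t)"
  by (induction t) auto

lemma finite_fv: "finite (fv \<phi>)"
  by (induction \<phi>) (auto simp: finite_fvt)

section \<open>The coincidence lemma, reducts and enlarged signatures\<close>

lemma eval_trm_cong: "(\<And>v. v \<in> fvt t \<Longrightarrow> e v = e' v) \<Longrightarrow> eval_trm M e t = eval_trm M e' t"
proof (induction t)
  case (Fun f ts)
  have "eval_trm M e t = eval_trm M e' t" if "t \<in> set ts" for t
    using that Fun.prems by (intro Fun.IH) auto
  then have "map (eval_trm M e) ts = map (eval_trm M e') ts" by simp
  then show ?case by (simp only: eval_trm.simps)
qed simp

lemma sat_cong: "(\<And>v. v \<in> fv \<phi> \<Longrightarrow> e v = e' v) \<Longrightarrow> sat M e \<phi> = sat M e' \<phi>"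
proof (induction \<phi> arbitrary: e e')
  case (Eq s t)
  have "eval_trm M e s = eval_trm M e' s" "eval_trm M e t = eval_trm M e' t"
    using Eq by (auto intro!: eval_trm_cong)
  then show ?case by simp
next
  case (Rel R ts)
  have "map (eval_trm M e) ts = map (eval_trm M e') ts"
    using Rel by (auto intro!: eval_trm_cong)
  then show ?case by (simp only: sat.simps)
next
  case (Ex x \<phi>)
  have "sat M (e(x := a)) \<phi> = sat M (e'(x := a)) \<phi>" for a
    using Ex.prems by (intro Ex.IH) auto
  then show ?case by simp
next
  case (Conj \<phi> \<psi>)
  have "sat M e \<phi> = sat M e' \<phi>" "sat M e \<psi> = sat M e' \<psi>"
    using Conj.prems by (intro Conj.IH; simp)+
  then show ?case by simp
next
  case (Neg \<phi>)
  have "sat M e \<phi> = sat M e' \<phi>"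
    using Neg.prems by (intro Neg.IH) simp
  then show ?case by simp
qed

lemma eval_trm_reduct: "is_trm \<Sigma> t \<Longrightarrow> eval_trm (reduct M \<Sigma>) e t = eval_trm M e t"
proof (induction t)
  case (Fun f ts)
  then have "map (eval_trm (reduct M \<Sigma>) e) ts = map (eval_trm M e) ts"
    by (auto simp: list_all_iff)
  then show ?case using Fun.prems by (simp add: reduct_def del: map_eq_conv)
qed simp

lemma sat_reduct: "is_fm \<Sigma> \<phi> \<Longrightarrow> sat (reduct M \<Sigma>) e \<phi> = sat M e \<phi>"
proof (induction \<phi> arbitrary: e)
  case (Rel R ts)
  then have "map (eval_trm (reduct M \<Sigma>) e) ts = map (eval_trm M e) ts"
    by (auto simp: list_all_iff eval_trm_reduct)
  then show ?case using Rel by (simp add: reduct_def del: map_eq_conv)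
next
  case (Ex x \<phi>)
  then show ?case by (simp add: reduct_def)
qed (auto simp: eval_trm_reduct)

text \<open>The condition evaluates formulas of \<Sigma> only, and these have the same value in
  \<open>M\<close> and in its reduct; the elements \<open>[c]\<close> and the universe are taken
  from \<open>M\<close> on both sides.\<close>

lemma preserving_condition_reduct:
  "preserving_condition \<Sigma> C T M (reduct M \<Sigma>) = preserving_condition \<Sigma> C T M M"
proof -
  have "solutions (reduct M \<Sigma>) \<phi> xs as = solutions M \<phi> xs as" if "is_fm \<Sigma> \<phi>" for \<phi> xs as
    using that by (simp add: solutions_def sat_reduct) (simp add: reduct_def)
  then show ?thesis
    unfolding preserving_condition_def ex_partially_preserving_def by auto
qed

text \<open>Disjointness keeps the old arities: \<open>add_consts\<close> gives every symbol of
  \<open>C\<close> arity 0.\<close>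

lemma is_trm_add_consts:
  "C \<inter> funs \<Sigma> = {} \<Longrightarrow> is_trm \<Sigma> t \<Longrightarrow> is_trm (add_consts \<Sigma> C) t"
  by (induction t) (auto simp: add_consts_def list_all_iff)

lemma is_fm_add_consts:
  "C \<inter> funs \<Sigma> = {} \<Longrightarrow> is_fm \<Sigma> \<phi> \<Longrightarrow> is_fm (add_consts \<Sigma> C) \<phi>"
  by (induction \<phi>) (auto simp: list_all_iff is_trm_add_consts, auto simp: add_consts_def)

text \<open>Lets a finite list serve as an assignment of all variables: variable \<open>i\<close>
  gets the entry number \<open>i\<close>, the remaining ones get a default \<open>c\<close>, and the
  first \<open>n\<close> variables give back the list.\<close>

lemma map_pad:
  "length cs = n \<Longrightarrow> map (\<lambda>i. g (if i < n then cs ! i else c)) [0..<n] = map g cs"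
  by (rule nth_equalityI) auto

lemma map_of_zip_upt:
  "map_of (zip [0..<n] (map f [0..<n])) v = (if v < n then Some (f v) else None)"
  by (simp add: map_of_zip_map)

section \<open>Complete theories with witnesses\<close>

locale henkin_theory =
  fixes \<Sigma> :: "('f, 'r) signature" and C :: "'f set" and T :: "('f, 'r) fm set"
  assumes new: "C \<inter> funs \<Sigma> = {}"
    and complete: "complete_theory (add_consts \<Sigma> C) T"
    and witnesses: "has_witnesses C T"
begin

abbreviation "\<Sigma>C \<equiv> add_consts \<Sigma> C"

section \<open>Membership in \<open>T\<close> and the logical connectives\<close>

lemma sentence_of: "\<phi> \<in> T \<Longrightarrow> is_fm \<Sigma>C \<phi> \<and> fv \<phi> = {}"
  using complete unfolding complete_theory_def is_theory_def is_sentence_def by auto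

lemma provableI: "\<phi> \<in> T \<Longrightarrow> provable \<Sigma>C T \<phi>"
  by (rule provable.assm) (simp_all add: sentence_of)

lemma mem_or_Neg_mem: "is_fm \<Sigma>C \<phi> \<Longrightarrow> fv \<phi> = {} \<Longrightarrow> \<phi> \<in> T \<or> Neg \<phi> \<in> T"
  using complete by (simp add: complete_theory_def is_sentence_def)

lemma not_both_provable: "provable \<Sigma>C T \<phi> \<Longrightarrow> \<not> provable \<Sigma>C T (Neg \<phi>)"
  using complete by (simp add: complete_theory_def consistent_def)

text \<open>Otherwise completeness would put \<open>Neg \<phi>\<close> into \<open>T\<close>,
  against consistency.\<close>

lemma provable_imp_mem:
  "provable \<Sigma>C T \<phi> \<Longrightarrow> is_fm \<Sigma>C \<phi> \<Longrightarrow> fv \<phi> = {} \<Longrightarrow> \<phi> \<in> T"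
  using mem_or_Neg_mem[of \<phi>] not_both_provable[of \<phi>] provableI[of "Neg \<phi>"] by argo

lemma Neg_mem_iff: "is_fm \<Sigma>C \<phi> \<Longrightarrow> fv \<phi> = {} \<Longrightarrow> Neg \<phi> \<in> T \<longleftrightarrow> \<phi> \<notin> T"
  using mem_or_Neg_mem[of \<phi>] not_both_provable[of \<phi>] provableI[of "Neg \<phi>"] provableI[of \<phi>]
  by argo

lemma Conj_mem_iff: "Conj \<phi> \<psi> \<in> T \<longleftrightarrow> \<phi> \<in> T \<and> \<psi> \<in> T"
proof
  assume *: "Conj \<phi> \<psi> \<in> T"
  show "\<phi> \<in> T \<and> \<psi> \<in> T"
    using sentence_of[OF *] provable_imp_mem[OF provable.conjE1[OF provableI[OF *]]]
      provable_imp_mem[OF provable.conjE2[OF provableI[OF *]]] by simp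
next
  assume *: "\<phi> \<in> T \<and> \<psi> \<in> T"
  then show "Conj \<phi> \<psi> \<in> T"
    using sentence_of[of \<phi>] sentence_of[of \<psi>]
      provable_imp_mem[OF provable.conjI[OF provableI[of \<phi>] provableI[of \<psi>]]] by simp
qed

lemma is_trm_Const: "c \<in> C \<Longrightarrow> is_trm \<Sigma>C (Const c)"
  by (simp add: add_consts_def)

text \<open>The counterpart of the witness property: together with \<open>Ex_memE\<close> it reduces
  an existential sentence of \<open>T\<close> to its instances at constants of \<open>C\<close>. The
  term may be a variable, which serves for vacuous quantifiers below.\<close>

lemma Ex_memI:
  assumes "subst1 x t \<phi> \<in> T" "is_fm \<Sigma>C \<phi>" "is_trm \<Sigma>C t" "free_for t x \<phi>" "fv \<phi> \<subseteq> {x}"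
  shows "Ex x \<phi> \<in> T"
proof (rule provable_imp_mem)
  show "provable \<Sigma>C T (Ex x \<phi>)"
    using assms by (intro provable.exI provableI)
qed (use assms in auto)

lemma Ex_memE:
  assumes "Ex x \<phi> \<in> T"
  obtains c where "c \<in> C" "subst1 x (Const c) \<phi> \<in> T"
  using assms witnesses unfolding has_witnesses_def by blast

lemma Eq_refl: "is_trm \<Sigma>C t \<Longrightarrow> fvt t = {} \<Longrightarrow> Eq t t \<in> T"
  by (rule provable_imp_mem[OF provable.refl]) simp_all

section \<open>Replacement of equals inside \<open>T\<close>, and names for closed terms\<close>

lemma replace1:
  assumes "Eq s t \<in> T" "subst1 x s \<phi> \<in> T" "is_fm \<Sigma>C \<phi>" "fv \<phi> \<subseteq> {x}"
  shows "subst1 x t \<phi> \<in> T"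
proof (rule provable_imp_mem)
  \<comment> \<open>An equation in \<open>T\<close> is a sentence, so both of its sides are closed
    and no variable can be captured.\<close>
  have st: "is_trm \<Sigma>C s" "is_trm \<Sigma>C t" "fvt s = {}" "fvt t = {}"
    using sentence_of[OF assms(1)] by auto
  show "provable \<Sigma>C T (subst1 x t \<phi>)"
    by (rule provable.repl[OF assms(3) _ _ provableI[OF assms(1)] provableI[OF assms(2)]])
      (simp_all add: free_for_closed st)
  show "is_fm \<Sigma>C (subst1 x t \<phi>)"
    unfolding subst1_def using assms st by (intro is_fm_subst) auto
  have "fv (subst1 x t \<phi>) \<subseteq> {}"
    unfolding subst1_def by (rule fv_subst_subsetI) (use assms(4) st in auto)
  then show "fv (subst1 x t \<phi>) = {}" by simp
qed

lemma Eq_sym: "Eq s t \<in> T \<Longrightarrow> Eq t s \<in> T"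
  using replace1[of s t 0 "Eq (Var 0) s"] sentence_of[of "Eq s t"] Eq_refl[of s]
  by (simp add: subst1_def substt_closed)

lemma Eq_trans: "Eq s t \<in> T \<Longrightarrow> Eq t u \<in> T \<Longrightarrow> Eq s u \<in> T"
  using replace1[of t u 0 "Eq s (Var 0)"] sentence_of[of "Eq s t"]
  by (simp add: subst1_def substt_closed)

text \<open>The replacement rule treats one variable at a time. The induction runs over the finite
  set \<open>A\<close> of variables already switched from \<sigma> to \<tau>; it is applied to the
  free variables of \<phi>.\<close>

lemma replace:
  assumes eq: "\<And>v. Eq (\<sigma> v) (\<tau> v) \<in> T" and fm: "is_fm \<Sigma>C \<phi>" and mem: "subst \<sigma> \<phi> \<in> T"
  shows "subst \<tau> \<phi> \<in> T"
proof -
  have cl: "is_trm \<Sigma>C (\<sigma> v)" "is_trm \<Sigma>C (\<tau> v)" "fvt (\<sigma> v) = {}" "fvt (\<tau> v) = {}" for v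
    using sentence_of[OF eq[of v]] by auto
  have "subst (\<lambda>v. if v \<in> A then \<tau> v else \<sigma> v) \<phi> \<in> T" if "finite A" for A
    using that
  proof (induction A rule: finite_induct)
    case empty
    then show ?case using mem by simp
  next
    case (insert x A)
    \<comment> \<open>Leaving \<open>x\<close> untouched gives a formula in the single variable
      \<open>x\<close> whose instances at \<open>\<sigma> x\<close> and \<open>\<tau> x\<close> are
      the formulas before and after the switch at \<open>x\<close>.\<close>
    define \<rho> where "\<rho> = (\<lambda>v. if v \<in> A then \<tau> v else \<sigma> v)(x := Var x)"
    have subst_\<rho>: "subst1 x t (subst \<rho> \<phi>) = subst (\<rho>(x := t)) \<phi>" for t
    proof -
      have "subst1 x t (subst \<rho> \<phi>) = subst (\<lambda>v. substt (Var(x := t)) (\<rho> v)) \<phi>"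
        unfolding subst1_def by (rule subst_subst) (auto simp: \<rho>_def cl)
      also have "(\<lambda>v. substt (Var(x := t)) (\<rho> v)) = \<rho>(x := t)"
        by (auto simp: \<rho>_def cl substt_closed)
      finally show ?thesis .
    qed
    have eqs: "\<rho>(x := \<sigma> x) = (\<lambda>v. if v \<in> A then \<tau> v else \<sigma> v)"
        "\<rho>(x := \<tau> x) = (\<lambda>v. if v \<in> insert x A then \<tau> v else \<sigma> v)"
      using insert by (auto simp: \<rho>_def)
    have "subst1 x (\<tau> x) (subst \<rho> \<phi>) \<in> T"
    proof (rule replace1[OF eq])
      show "subst1 x (\<sigma> x) (subst \<rho> \<phi>) \<in> T"
        unfolding subst_\<rho> eqs using insert.IH .
      show "is_fm \<Sigma>C (subst \<rho> \<phi>)"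
        using fm cl by (intro is_fm_subst) (auto simp: \<rho>_def)
      show "fv (subst \<rho> \<phi>) \<subseteq> {x}"
        by (rule fv_subst_subsetI) (simp add: \<rho>_def cl)
    qed
    then show ?case unfolding subst_\<rho> eqs .
  qed
  from this[OF finite_fv[of \<phi>]] show ?thesis
    using subst_cong[of \<phi> "\<lambda>v. if v \<in> fv \<phi> then \<tau> v else \<sigma> v" \<tau>] by simp
qed

lemma replace_iff:
  assumes "\<And>v. Eq (\<sigma> v) (\<tau> v) \<in> T" "is_fm \<Sigma>C \<phi>"
  shows "subst \<sigma> \<phi> \<in> T \<longleftrightarrow> subst \<tau> \<phi> \<in> T"
  using replace[of \<sigma> \<tau> \<phi>] replace[of \<tau> \<sigma> \<phi>] assms Eq_sym by blast

text \<open>From \<open>Eq t t\<close> in \<open>T\<close> follows that something equals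
  \<open>t\<close>; the witness of this existential sentence is the name.\<close>

lemma name_exists:
  assumes "is_trm \<Sigma>C t" "fvt t = {}"
  obtains c where "c \<in> C" "Eq t (Const c) \<in> T"
proof -
  have "Ex 0 (Eq t (Var 0)) \<in> T"
    using assms Eq_refl[of t]
    by (intro Ex_memI[of 0 t]) (auto simp: subst1_def substt_closed)
  then obtain c where "c \<in> C" "subst1 0 (Const c) (Eq t (Var 0)) \<in> T"
    by (rule Ex_memE)
  then show ?thesis
    using that assms by (simp add: subst1_def substt_closed)
qed

text \<open>A witness for \<open>\<exists>x. x \<approx> x\<close> is a constant of
  \<open>C\<close>. The sentence itself is derived with a variable as the instantiating term,
  because no closed term is available yet.\<close>

lemma C_nonempty: "C \<noteq> {}"
proof -
  have "Ex 0 (Eq (Var 0) (Var 0)) \<in> T"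
    by (intro provable_imp_mem provable.exI[of _ _ "Var 0"])
      (simp_all add: subst1_def provable.refl)
  then obtain c where "c \<in> C" by (rule Ex_memE)
  then show ?thesis by blast
qed

text \<open>Both atoms are instances of one atom over the distinct variables
  \<open>0, ..., n - 1\<close>, where \<open>n\<close> is the arity, so simultaneous replacement
  applies.\<close>

lemma Rel_replace:
  assumes len: "length ss = length ts" "length ss = rar \<Sigma> R" and "R \<in> rels \<Sigma>"
    and eq: "\<And>i. i < length ss \<Longrightarrow> Eq (ss ! i) (ts ! i) \<in> T"
  shows "Rel R ss \<in> T \<longleftrightarrow> Rel R ts \<in> T"
proof -
  obtain d where d: "d \<in> C" using C_nonempty by blast
  \<comment> \<open>Replacement asks for an equation at every variable; beyond the arity the default
    makes it \<open>Eq (Const d) (Const d)\<close>.\<close>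
  let ?s = "\<lambda>us i. if i < length ss then us ! i else Const d"
  have "map (substt (?s us)) (map Var [0..<length ss]) = us" if "length us = length ss" for us
    using map_pad[OF that, of id] by (simp add: comp_def)
  then have *: "subst (?s us) (Rel R (map Var [0..<length ss])) = Rel R us"
    if "length us = length ss" for us
    using that by (simp only: subst.simps)
  have "subst (?s ss) (Rel R (map Var [0..<length ss])) \<in> T
      \<longleftrightarrow> subst (?s ts) (Rel R (map Var [0..<length ss])) \<in> T"
    using assms d Eq_refl[of "Const d"] is_trm_Const[OF d]
    by (intro replace_iff) (auto simp: list_all_iff add_consts_def)
  then show ?thesis using * len by simp
qed

lemma Fun_replace:
  assumes len: "length ss = length ts" "length ss = far \<Sigma> f" and "f \<in> funs \<Sigma>"
    and eq: "\<And>i. i < length ss \<Longrightarrow> Eq (ss ! i) (ts ! i) \<in> T" and d: "d \<in> C"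
  shows "Eq (Fun f ss) (Const d) \<in> T \<longleftrightarrow> Eq (Fun f ts) (Const d) \<in> T"
proof -
  \<comment> \<open>As for relations, with the constant \<open>d\<close> on the right of the
    equation doubling as the default value.\<close>
  let ?s = "\<lambda>us i. if i < length ss then us ! i else Const d"
  let ?\<phi> = "Eq (Fun f (map Var [0..<length ss])) (Const d)"
  have "map (substt (?s us)) (map Var [0..<length ss]) = us" if "length us = length ss" for us
    using map_pad[OF that, of id] by (simp add: comp_def)
  then have *: "subst (?s us) ?\<phi> = Eq (Fun f us) (Const d)"
    if "length us = length ss" for us
    using that by (simp only: subst.simps substt.simps list.map)
  have "f \<notin> C" using new assms(3) by blast
  then have "subst (?s ss) ?\<phi> \<in> T \<longleftrightarrow> subst (?s ts) ?\<phi> \<in> T"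
    using assms d Eq_refl[of "Const d"] is_trm_Const[OF d]
    by (intro replace_iff) (auto simp: list_all_iff add_consts_def)
  then show ?thesis using * len by simp
qed

section \<open>Independence of the canonical structure from representatives\<close>

lemma const_class_eq_iff:
  assumes "c \<in> C" "d \<in> C"
  shows "const_class C T c = const_class C T d \<longleftrightarrow> Eq (Const c) (Const d) \<in> T"
proof
  assume "const_class C T c = const_class C T d"
  moreover have "c \<in> const_class C T c"
    using assms Eq_refl[of "Const c"] is_trm_Const by (simp add: const_class_def)
  ultimately show "Eq (Const c) (Const d) \<in> T" by (simp add: const_class_def)
next
  assume "Eq (Const c) (Const d) \<in> T"
  then show "const_class C T c = const_class C T d"
    unfolding const_class_def using Eq_trans Eq_sym by blast
qed

lemma map_const_class_eqD:
  assumes "map (const_class C T) cs = map (const_class C T) ds" "set cs \<subseteq> C" "set ds \<subseteq> C"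
  shows "length cs = length ds"
    and "i < length cs \<Longrightarrow> Eq (map Const cs ! i) (map Const ds ! i) \<in> T"
proof -
  show len: "length cs = length ds" using assms(1) by (rule map_eq_imp_length_eq)
  assume i: "i < length cs"
  then have "const_class C T (cs ! i) = const_class C T (ds ! i)"
    using assms(1) len by (metis nth_map)
  then show "Eq (map Const cs ! i) (map Const ds ! i) \<in> T"
    using const_class_eq_iff[of "cs ! i" "ds ! i"] assms(2,3) i len by (auto simp: subset_eq)
qed

text \<open>Justifies the definite description in \<open>canonical_struct\<close>. A value exists
  since the closed term \<open>f(c1, ..., cn)\<close> has a name; it is unique since equal classes
  of arguments allow replacement and any two names of one term are equal modulo
  \<open>T\<close>.\<close>

lemma funI_canonical:
  assumes f: "f \<in> funs \<Sigma>" "length cs = far \<Sigma> f" and cs: "set cs \<subseteq> C" and c: "c \<in> C"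
  shows "funI (canonical_struct C T) f (map (const_class C T) cs) = const_class C T c
    \<longleftrightarrow> Eq (Fun f (map Const cs)) (Const c) \<in> T"
proof -
  have fC: "f \<notin> C" using f new by blast
  have "is_trm \<Sigma>C (Fun f (map Const cs))" "fvt (Fun f (map Const cs)) = {}"
    using f cs fC by (auto simp: add_consts_def list_all_iff)
  then obtain d where d: "d \<in> C" "Eq (Fun f (map Const cs)) (Const d) \<in> T"
    by (rule name_exists)
  have "funI (canonical_struct C T) f (map (const_class C T) cs) =
    (THE a. \<exists>cs' c. set cs' \<subseteq> C \<and> c \<in> C \<and> map (const_class C T) cs = map (const_class C T) cs' \<and>
          a = const_class C T c \<and> Eq (Fun f (map Const cs')) (Const c) \<in> T)"
    using fC unfolding canonical_struct_def by simp
  also have "\<dots> = const_class C T d"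
  proof (rule the_equality)
    fix a
    assume "\<exists>cs' c. set cs' \<subseteq> C \<and> c \<in> C \<and> map (const_class C T) cs = map (const_class C T) cs' \<and>
          a = const_class C T c \<and> Eq (Fun f (map Const cs')) (Const c) \<in> T"
    then obtain cs' c' where *: "set cs' \<subseteq> C" "c' \<in> C"
      "map (const_class C T) cs = map (const_class C T) cs'"
      "a = const_class C T c'" "Eq (Fun f (map Const cs')) (Const c') \<in> T" by blast
    have "Eq (Fun f (map Const cs)) (Const c') \<in> T"
      using Fun_replace[of "map Const cs" "map Const cs'" f c'] map_const_class_eqD[of cs cs'] * f cs
      by auto
    then have "Eq (Const c') (Const d) \<in> T"
      using d Eq_sym Eq_trans by blast
    then show "a = const_class C T d"
      using * d by (simp add: const_class_eq_iff)
  qed (use d cs in blast)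
  finally have "funI (canonical_struct C T) f (map (const_class C T) cs) = const_class C T d" .
  then show ?thesis
    using const_class_eq_iff[OF d(1) c] d Eq_sym Eq_trans by metis
qed

text \<open>The definition asks for some representatives satisfying the atom; by replacement the
  given ones then satisfy it as well.\<close>

lemma relI_canonical:
  assumes R: "R \<in> rels \<Sigma>" "length cs = rar \<Sigma> R" and cs: "set cs \<subseteq> C"
  shows "relI (canonical_struct C T) R (map (const_class C T) cs) \<longleftrightarrow> Rel R (map Const cs) \<in> T"
proof
  assume "relI (canonical_struct C T) R (map (const_class C T) cs)"
  then obtain cs' where *: "set cs' \<subseteq> C" "map (const_class C T) cs = map (const_class C T) cs'"
      "Rel R (map Const cs') \<in> T" by (auto simp: canonical_struct_def)
  then show "Rel R (map Const cs) \<in> T"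
    using Rel_replace[of "map Const cs" "map Const cs'" R] map_const_class_eqD[of cs cs'] R cs
    by auto
qed (use cs in \<open>auto simp: canonical_struct_def\<close>)

section \<open>Structures all of whose elements are named\<close>

text \<open>The truth lemma for \<phi>, as a property of \<phi>. The assignment \<open>e\<close>
  gives a constant to every variable, so that every instance is a sentence and the quantifier step
  only has to update \<open>e\<close> at one variable.\<close>

definition agrees :: "('f, 'r, 'a) struct \<Rightarrow> ('f, 'r) fm \<Rightarrow> bool" where
  "agrees M \<phi> \<longleftrightarrow> (\<forall>e. range e \<subseteq> C \<longrightarrow>
    (sat M (\<lambda>v. named M (e v)) \<phi> \<longleftrightarrow> subst (\<lambda>v. Const (e v)) \<phi> \<in> T))"

lemma instance_sentence:
  assumes "is_fm \<Sigma> \<phi>" "range e \<subseteq> C"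
  shows "is_fm \<Sigma>C (subst (\<lambda>v. Const (e v)) \<phi>)" "fv (subst (\<lambda>v. Const (e v)) \<phi>) = {}"
proof -
  show "is_fm \<Sigma>C (subst (\<lambda>v. Const (e v)) \<phi>)"
    using assms is_trm_Const by (intro is_fm_subst is_fm_add_consts new) auto
  have "fv (subst (\<lambda>v. Const (e v)) \<phi>) \<subseteq> {}"
    by (rule fv_subst_subsetI) simp
  then show "fv (subst (\<lambda>v. Const (e v)) \<phi>) = {}" by simp
qed

lemma named_in_univ:
  assumes "is_struct \<Sigma>C M" "c \<in> C"
  shows "named M c \<in> univ M"
proof -
  have "c \<in> funs \<Sigma>C" "far \<Sigma>C c = 0" using assms(2) by (auto simp: add_consts_def)
  then show ?thesis
    using assms(1) unfolding is_struct_def named_def by (metis lists.Nil list.size(3))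
qed

section \<open>Agreement on all formulas and the preserving condition\<close>

lemma preserving_if_agrees:
  assumes struct: "is_struct \<Sigma>C M" and agr: "\<And>\<phi>. is_fm \<Sigma> \<phi> \<Longrightarrow> agrees M \<phi>"
  shows "preserving_condition \<Sigma> C T M M"
  unfolding preserving_condition_def
proof (intro allI impI)
  fix \<phi> :: "('f, 'r) fm" and xs x cs
  assume fm: "is_fm \<Sigma> \<phi>" and "distinct (xs @ [x])" and fv: "fv \<phi> \<subseteq> set (xs @ [x])"
    and len: "length cs = length xs" and cs: "set cs \<subseteq> C"
    and mem: "Ex x (subst_consts xs cs \<phi>) \<in> T"
  then have x: "x \<notin> set xs" by auto
  obtain c where c: "c \<in> C" "subst1 x (Const c) (subst_consts xs cs \<phi>) \<in> T"
    using mem by (rule Ex_memE)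
  \<comment> \<open>The constant \<open>c\<close> is the witness taken from \<open>T\<close>. All
    variables outside the parameters are sent to it, just as \<open>solutions\<close> sends them to
    one element.\<close>
  define e where "e v = (case map_of (zip xs cs) v of Some d \<Rightarrow> d | None \<Rightarrow> c)" for v
  have e: "range e \<subseteq> C"
    using cs c(1) by (auto simp: e_def split: option.splits dest!: map_of_SomeD set_zip_rightD)
  have "subst1 x (Const c) (subst_consts xs cs \<phi>) = subst (\<lambda>v. substt (Var(x := Const c))
      (case map_of (zip xs cs) v of Some c \<Rightarrow> Const c | None \<Rightarrow> Var v)) \<phi>"
    unfolding subst1_def subst_consts_def by (rule subst_subst) (auto split: option.splits)
  also have "\<dots> = subst (\<lambda>v. Const (e v)) \<phi>"
  \<comment> \<open>Only free variables of \<phi> matter: on a variable that is neither a parameter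
    nor \<open>x\<close> the two substitutions differ, one leaving it alone and the other inserting
    \<open>c\<close>.\<close>
  proof (rule subst_cong)
    fix v assume "v \<in> fv \<phi>"
    then consider "v \<in> set xs" "v \<noteq> x" | "v = x" "map_of (zip xs cs) x = None"
      using fv x map_of_zip_is_None[of xs cs x] len by auto
    then show "substt (Var(x := Const c))
      (case map_of (zip xs cs) v of Some c \<Rightarrow> Const c | None \<Rightarrow> Var v) = Const (e v)"
    proof cases
      case 1
      then show ?thesis using len by (auto simp: e_def split: option.splits)
    next
      case 2
      then show ?thesis unfolding e_def by (simp only: option.case substt.simps fun_upd_same)
    qed
  qed
  finally have "subst (\<lambda>v. Const (e v)) \<phi> \<in> T" using c by simp
  then have sat: "sat M (\<lambda>v. named M (e v)) \<phi>"
    using agr[OF fm] e unfolding agrees_def by blast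
  have "(\<lambda>v. case map_of (zip xs (map (named M) cs)) v of Some a \<Rightarrow> a | None \<Rightarrow> named M c)
      = (\<lambda>v. named M (e v))"
    by (auto simp: e_def zip_map2 map_of_map split: option.splits)
  then have "named M c \<in> solutions M \<phi> xs (map (named M) cs)"
    unfolding solutions_def using sat named_in_univ[OF struct c(1)] by simp
  then show "ex_partially_preserving M \<phi> xs (map (named M) cs) (univ M)"
    unfolding ex_partially_preserving_def using named_in_univ[OF struct c(1)] by blast
qed

text \<open>The preserving condition gives only the passage from membership in \<open>T\<close> to
  truth in \<open>M\<close>. The converse comes from the same passage for \<open>Neg \<phi>\<close>,
  since completeness puts one of \<phi> and its negation into \<open>T\<close> at each
  instance.\<close>

lemma agrees_if_preserving:
  assumes pres: "preserving_condition \<Sigma> C T M M" and fm: "is_fm \<Sigma> \<phi>"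
  shows "agrees M \<phi>"
proof -
  have sat: "sat M (\<lambda>v. named M (e v)) \<psi>"
    if fm: "is_fm \<Sigma> \<psi>" and e: "range e \<subseteq> C" and mem: "subst (\<lambda>v. Const (e v)) \<psi> \<in> T" for \<psi> e
  proof -
    \<comment> \<open>All variables below \<open>n\<close> become parameters, and \<open>n\<close>
      itself, which is not free in \<psi>, is the dummy variable.\<close>
    obtain n where n: "fv \<psi> \<subseteq> {..<n}"
      using finite_fv[of \<psi>] unfolding finite_nat_set_iff_bounded by blast
    let ?xs = "[0..<n]" and ?cs = "map e [0..<n]"
    have sc: "subst_consts ?xs ?cs \<psi> = subst (\<lambda>v. Const (e v)) \<psi>"
      unfolding subst_consts_def map_of_zip_upt using n by (intro subst_cong) auto
    \<comment> \<open>The quantifier is vacuous, so it is introduced with the variable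
      \<open>n\<close> as its own instance, which leaves the sentence unchanged.\<close>
    have "Ex n (subst_consts ?xs ?cs \<psi>) \<in> T"
      unfolding sc using mem instance_sentence[OF fm e]
      by (intro Ex_memI[of n "Var n"]) (auto simp: subst1_def fun_upd_idem intro: free_for_nonfree)
    then have "ex_partially_preserving M \<psi> ?xs (map (named M) ?cs) (univ M)"
      using pres fm n e unfolding preserving_condition_def
      by (elim allE[of _ \<psi>] allE[of _ ?xs] allE[of _ n] allE[of _ ?cs]) fastforce
    then obtain b where "sat M (\<lambda>v. case map_of (zip ?xs (map (named M) ?cs)) v of
        Some a \<Rightarrow> a | None \<Rightarrow> b) \<psi>"
      unfolding ex_partially_preserving_def solutions_def by blast
    \<comment> \<open>The solution \<open>b\<close> is assigned only to variables from
      \<open>n\<close> on, none of which is free in \<psi>.\<close>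
    then show ?thesis
      unfolding map_map map_of_zip_upt comp_def
      by (subst (asm) sat_cong[of \<psi> _ "\<lambda>v. named M (e v)"]) (use n in auto)
  qed
  show ?thesis
    unfolding agrees_def
  proof (intro allI impI iffI)
    fix e :: "nat \<Rightarrow> 'f" assume e: "range e \<subseteq> C" and s: "sat M (\<lambda>v. named M (e v)) \<phi>"
    show "subst (\<lambda>v. Const (e v)) \<phi> \<in> T"
    proof (rule ccontr)
      assume "subst (\<lambda>v. Const (e v)) \<phi> \<notin> T"
      then have "subst (\<lambda>v. Const (e v)) (Neg \<phi>) \<in> T"
        using Neg_mem_iff instance_sentence[OF fm e] by simp
      then show False using sat[of "Neg \<phi>" e] fm e s by simp
    qed
  qed (use fm sat in blast)
qed

text \<open>Specializes agreement to atoms whose arguments are variables; these are exactly the data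
  from which the canonical structure is built.\<close>

lemma agrees_flat:
  assumes agr: "\<And>\<phi>. is_fm \<Sigma> \<phi> \<Longrightarrow> agrees M \<phi>"
  shows "c \<in> C \<Longrightarrow> d \<in> C \<Longrightarrow> named M c = named M d \<longleftrightarrow> Eq (Const c) (Const d) \<in> T"
    and "f \<in> funs \<Sigma> \<Longrightarrow> length cs = far \<Sigma> f \<Longrightarrow> set cs \<subseteq> C \<Longrightarrow> c \<in> C \<Longrightarrow>
      funI M f (map (named M) cs) = named M c \<longleftrightarrow> Eq (Fun f (map Const cs)) (Const c) \<in> T"
    and "R \<in> rels \<Sigma> \<Longrightarrow> length cs = rar \<Sigma> R \<Longrightarrow> set cs \<subseteq> C \<Longrightarrow>
      relI M R (map (named M) cs) \<longleftrightarrow> Rel R (map Const cs) \<in> T"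
proof -
  assume "c \<in> C" "d \<in> C"
  then show "named M c = named M d \<longleftrightarrow> Eq (Const c) (Const d) \<in> T"
    using agr[of "Eq (Var 0) (Var 1)"] unfolding agrees_def
    by (elim meta_impE allE[of _ "\<lambda>v. if v = 0 then c else d"]) (auto split: if_splits)
next
  let ?n = "length cs"
  \<comment> \<open>Variables below \<open>?n\<close> carry the arguments \<open>cs\<close>; every
    later variable gets \<open>c\<close>, in particular \<open>?n\<close>, which stands for the
    value of the function.\<close>
  let ?e = "\<lambda>c i. if i < ?n then cs ! i else c"
  let ?t = "\<lambda>f. Fun f (map Var [0..<?n])"
  have map_e: "map (\<lambda>i. named M (?e c i)) [0..<?n] = map (named M) cs"
      "map (\<lambda>i. Const (?e c i)) [0..<?n] = map Const cs" for c
    by (rule map_pad, simp)+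
  {
    assume *: "f \<in> funs \<Sigma>" "length cs = far \<Sigma> f" "set cs \<subseteq> C" "c \<in> C"
    then have "range (?e c) \<subseteq> C" by auto
    moreover have "agrees M (Eq (?t f) (Var ?n))"
      using * by (intro agr) (auto simp: list_all_iff)
    ultimately show "funI M f (map (named M) cs) = named M c
        \<longleftrightarrow> Eq (Fun f (map Const cs)) (Const c) \<in> T"
      unfolding agrees_def
      by (elim allE[of _ "?e c"]) (simp add: comp_def map_e del: map_eq_conv)
  next
    assume *: "R \<in> rels \<Sigma>" "length cs = rar \<Sigma> R" "set cs \<subseteq> C"
    obtain c where "c \<in> C" using C_nonempty by blast
    with * have "range (?e c) \<subseteq> C" by auto
    moreover have "agrees M (Rel R (map Var [0..<?n]))"
      using * by (intro agr) (auto simp: list_all_iff)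
    ultimately show "relI M R (map (named M) cs) \<longleftrightarrow> Rel R (map Const cs) \<in> T"
      unfolding agrees_def
      by (elim allE[of _ "?e c"]) (simp add: comp_def map_e del: map_eq_conv)
  }
qed

section \<open>Agreement and isomorphism with the canonical structure\<close>

lemma lists_named:
  assumes names: "\<And>a. a \<in> univ M \<Longrightarrow> \<exists>c\<in>C. named M c = a" and "as \<in> lists (univ M)"
  obtains cs where "as = map (named M) cs" "set cs \<subseteq> C"
proof -
  obtain g where "\<And>a. a \<in> univ M \<Longrightarrow> g a \<in> C \<and> named M (g a) = a"
    using names by metis
  then show ?thesis
    using assms(2) by (intro that[of "map g as"]) (auto simp: map_idI in_lists_conv_set)
qed

text \<open>By the flat atoms, the names of one element form exactly one class of constants equal
  modulo \<open>T\<close>, and functions and relations are read off from \<open>T\<close>. The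
  classes are infinite because every element has infinitely many names.\<close>

lemma canonical_if_agrees:
  assumes struct: "is_struct \<Sigma>C M"
    and names: "\<And>a. a \<in> univ M \<Longrightarrow> infinite {c \<in> C. named M c = a}"
    and agr: "\<And>\<phi>. is_fm \<Sigma> \<phi> \<Longrightarrow> agrees M \<phi>"
  shows "is_canonical_model \<Sigma> C T M"
proof -
  note flat = agrees_flat[OF agr]
  have ex_name: "\<exists>c\<in>C. named M c = a" if "a \<in> univ M" for a
    using names[OF that] by (metis (mono_tags, lifting) empty_Collect_eq finite.emptyI)
  let ?N = "canonical_struct C T"
  \<comment> \<open>The isomorphism sends an element to the set of its names; it is injective
    because every element has a name.\<close>
  define h where "h a = {c \<in> C. named M c = a}" for a
  have h: "h (named M c) = const_class C T c" if "c \<in> C" for c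
    using flat(1) that unfolding const_class_def h_def by blast
  have map_h: "map (h \<circ> named M) cs = map (const_class C T) cs" if "set cs \<subseteq> C" for cs
    using that h by auto
  have "infinite (const_class C T c)" if "c \<in> C" for c
    using names[OF named_in_univ[OF struct that]] h[OF that] by (simp add: h_def)
  moreover have "is_isomorphism \<Sigma>C h M ?N"
    unfolding is_isomorphism_def
  proof (intro HOL.conjI ballI impI)
    show "bij_betw h (univ M) (univ ?N)"
    proof (rule bij_betw_imageI)
      show "inj_on h (univ M)"
        unfolding inj_on_def h_def using ex_name by blast
      have "univ M = named M ` C"
        using ex_name named_in_univ[OF struct] by blast
      then show "h ` univ M = univ ?N"
        using h by (auto simp: canonical_struct_def)
    qed
  next
    fix f as assume f: "f \<in> funs \<Sigma>C" "as \<in> lists (univ M)" "length as = far \<Sigma>C f"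
    show "h (funI M f as) = funI ?N f (map h as)"
    proof (cases "f \<in> C")
      case True
      then show ?thesis
        using f h by (simp add: add_consts_def canonical_struct_def flip: named_def)
    next
      case False
      then have f': "f \<in> funs \<Sigma>" "length as = far \<Sigma> f" using f by (auto simp: add_consts_def)
      obtain cs where cs: "as = map (named M) cs" "set cs \<subseteq> C"
        using lists_named[OF ex_name f(2)] by blast
      \<comment> \<open>The value is itself named by some \<open>c\<close>, so the computation in
        \<open>M\<close> becomes an equation in \<open>T\<close>, which the canonical structure
        reproduces.\<close>
      have "funI M f as \<in> univ M" using struct f unfolding is_struct_def by blast
      then obtain c where c: "c \<in> C" "named M c = funI M f as" using ex_name by blast
      then have "Eq (Fun f (map Const cs)) (Const c) \<in> T"
        using flat(2)[of f cs c] f' cs by simp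
      then have "funI ?N f (map (const_class C T) cs) = const_class C T c"
        using funI_canonical[of f cs c] f' cs c by simp
      then show ?thesis using map_h[OF cs(2)] h[OF c(1)] c cs by (simp del: map_eq_conv)
    qed
  next
    fix R as assume R: "R \<in> rels \<Sigma>C" "as \<in> lists (univ M)" "length as = rar \<Sigma>C R"
    then have R': "R \<in> rels \<Sigma>" "length as = rar \<Sigma> R" by (auto simp: add_consts_def)
    obtain cs where cs: "as = map (named M) cs" "set cs \<subseteq> C"
      using lists_named[OF ex_name R(2)] by blast
    show "relI M R as = relI ?N R (map h as)"
      using relI_canonical[of R cs] flat(3)[of R cs] R' cs map_h[OF cs(2)] by (simp del: map_eq_conv)
  qed
  ultimately show ?thesis unfolding is_canonical_model_def by blast
qed

text \<open>The isomorphism settles equations between constants and flat atoms. Compound terms are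
  reduced to these by naming their subterms, and the connectives and the quantifier follow by
  induction on \<phi>.\<close>

lemma agrees_if_canonical:
  assumes struct: "is_struct \<Sigma>C M"
    and names: "\<And>a. a \<in> univ M \<Longrightarrow> \<exists>c\<in>C. named M c = a"
    and canonical: "is_canonical_model \<Sigma> C T M" and fm: "is_fm \<Sigma> \<phi>"
  shows "agrees M \<phi>"
proof -
  let ?N = "canonical_struct C T"
  obtain h where "is_isomorphism \<Sigma>C h M ?N"
    using canonical unfolding is_canonical_model_def by blast
  then have inj: "inj_on h (univ M)"
    and h_fun: "\<And>f as. f \<in> funs \<Sigma>C \<Longrightarrow> as \<in> lists (univ M) \<Longrightarrow> length as = far \<Sigma>C f
      \<Longrightarrow> h (funI M f as) = funI ?N f (map h as)"
    and h_rel: "\<And>R as. R \<in> rels \<Sigma>C \<Longrightarrow> as \<in> lists (univ M) \<Longrightarrow> length as = rar \<Sigma>C R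
      \<Longrightarrow> relI M R as = relI ?N R (map h as)"
    unfolding is_isomorphism_def bij_betw_def by blast+
  have h: "h (named M c) = const_class C T c" if "c \<in> C" for c
    using h_fun[of c "[]"] that by (simp add: named_def canonical_struct_def add_consts_def)
  have map_h: "map (h \<circ> named M) cs = map (const_class C T) cs" if "set cs \<subseteq> C" for cs
    using that h by auto
  have in_lists: "map (named M) cs \<in> lists (univ M)" if "set cs \<subseteq> C" for cs
    using that named_in_univ[OF struct] by (auto simp: subset_eq)
  have named_eq: "named M c = named M d \<longleftrightarrow> Eq (Const c) (Const d) \<in> T" if "c \<in> C" "d \<in> C" for c d
    using that h const_class_eq_iff inj named_in_univ[OF struct] by (metis inj_on_eq_iff)
  have fun_flat: "funI M f (map (named M) cs) = named M c
      \<longleftrightarrow> Eq (Fun f (map Const cs)) (Const c) \<in> T"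
    if "f \<in> funs \<Sigma>" "length cs = far \<Sigma> f" "set cs \<subseteq> C" "c \<in> C" for f cs c
  proof -
    have f: "f \<in> funs \<Sigma>C" "far \<Sigma>C f = far \<Sigma> f"
      using that new by (auto simp: add_consts_def)
    then have "funI M f (map (named M) cs) \<in> univ M"
      using struct in_lists[OF that(3)] that(2) unfolding is_struct_def by simp
    \<comment> \<open>Both elements lie in the universe of \<open>M\<close>, so injectivity of
      \<open>h\<close> moves the comparison into the canonical structure.\<close>
    then have "funI M f (map (named M) cs) = named M c
        \<longleftrightarrow> h (funI M f (map (named M) cs)) = h (named M c)"
      using inj named_in_univ[OF struct that(4)] by (simp add: inj_on_eq_iff)
    also have "\<dots> \<longleftrightarrow> funI ?N f (map (const_class C T) cs) = const_class C T c"
      using h_fun[OF f(1) in_lists[OF that(3)]] that f h map_h[OF that(3)] by (simp del: map_eq_conv)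
    finally show ?thesis using funI_canonical that by simp
  qed
  have rel_flat: "relI M R (map (named M) cs) \<longleftrightarrow> Rel R (map Const cs) \<in> T"
    if "R \<in> rels \<Sigma>" "length cs = rar \<Sigma> R" "set cs \<subseteq> C" for R cs
    using h_rel[OF _ in_lists[OF that(3)], of R] map_h[OF that(3)] relI_canonical[OF that] that
    by (simp add: add_consts_def del: map_eq_conv)

  have instance_closed: "is_trm \<Sigma>C (substt (\<lambda>v. Const (e v)) t)"
      "fvt (substt (\<lambda>v. Const (e v)) t) = {}" if "is_trm \<Sigma> t" "range e \<subseteq> C" for t e
    using that by (auto simp: fvt_substt image_subset_iff simp del: is_trm.simps
        intro!: is_trm_substt is_trm_add_consts[OF new that(1)] is_trm_Const)
  have names_list: "\<exists>cs. length cs = length ts \<and> set cs \<subseteq> C \<and> (\<forall>i<length ts.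
      Eq (substt (\<lambda>v. Const (e v)) (ts ! i)) (Const (cs ! i)) \<in> T)"
    if "\<forall>t\<in>set ts. is_trm \<Sigma> t" "range e \<subseteq> C" for ts e
  proof -
    have "\<exists>c. c \<in> C \<and> Eq (substt (\<lambda>v. Const (e v)) t) (Const c) \<in> T" if "t \<in> set ts" for t
      using that \<open>\<forall>t\<in>set ts. is_trm \<Sigma> t\<close> instance_closed[OF _ \<open>range e \<subseteq> C\<close>] by (metis name_exists)
    then obtain g where "\<And>t. t \<in> set ts \<Longrightarrow>
        g t \<in> C \<and> Eq (substt (\<lambda>v. Const (e v)) t) (Const (g t)) \<in> T" by metis
    then show ?thesis by (intro HOL.exI[of _ "map g ts"]) auto
  qed

  \<comment> \<open>Comparing with an arbitrary constant \<open>c\<close> lets the induction use,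
    for each argument, the constant that names it; the application then becomes flat.\<close>
  have eval_eq: "eval_trm M (\<lambda>v. named M (e v)) t = named M c
      \<longleftrightarrow> Eq (substt (\<lambda>v. Const (e v)) t) (Const c) \<in> T"
    if "is_trm \<Sigma> t" "range e \<subseteq> C" "c \<in> C" for t e c
    using that
  proof (induction t arbitrary: c)
    case (Var v)
    then show ?case using named_eq by auto
  next
    case (Fun f ts)
    let ?s = "substt (\<lambda>v. Const (e v))"
    have ts: "f \<in> funs \<Sigma>" "length ts = far \<Sigma> f" "\<forall>t\<in>set ts. is_trm \<Sigma> t"
      using Fun.prems by (auto simp: list_all_iff)
    obtain cs where cs: "length cs = length ts" "set cs \<subseteq> C"
        "\<And>i. i < length ts \<Longrightarrow> Eq (?s (ts ! i)) (Const (cs ! i)) \<in> T"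
      using names_list[OF ts(3) Fun.prems(2)] by blast
    have "map (eval_trm M (\<lambda>v. named M (e v))) ts = map (named M) cs"
    proof (rule nth_equalityI)
      fix i assume "i < length (map (eval_trm M (\<lambda>v. named M (e v))) ts)"
      then have i: "i < length ts" by simp
      then have "cs ! i \<in> C" using cs by (metis nth_mem subsetD)
      then show "map (eval_trm M (\<lambda>v. named M (e v))) ts ! i = map (named M) cs ! i"
        using Fun.IH[of "ts ! i" "cs ! i"] i cs ts(3) Fun.prems(2) by simp
    qed (use cs in simp)
    then have "eval_trm M (\<lambda>v. named M (e v)) (Fun f ts) = funI M f (map (named M) cs)"
      by (simp only: eval_trm.simps)
    also have "\<dots> = named M c \<longleftrightarrow> Eq (Fun f (map Const cs)) (Const c) \<in> T"
      using fun_flat ts cs Fun.prems by simp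
    also have "\<dots> \<longleftrightarrow> Eq (Fun f (map ?s ts)) (Const c) \<in> T"
      using Fun_replace[of "map ?s ts" "map Const cs" f c] ts cs Fun.prems by simp
    finally show ?case by simp
  qed

  show ?thesis
    using fm
  proof (induction \<phi>)
    case (Eq s t)
    show ?case
      unfolding agrees_def
    proof (intro allI impI)
      fix e :: "nat \<Rightarrow> 'f" assume e: "range e \<subseteq> C"
      let ?s = "substt (\<lambda>v. Const (e v))"
      \<comment> \<open>A name of the right-hand side reduces the equation to the comparison of a
        term with a constant.\<close>
      obtain c where c: "c \<in> C" "Eq (?s t) (Const c) \<in> T"
        using instance_closed[of t e] e Eq.prems by (auto elim: name_exists)
      then have "eval_trm M (\<lambda>v. named M (e v)) t = named M c"
        using eval_eq[of t e c] e Eq.prems by simp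
      then have "sat M (\<lambda>v. named M (e v)) (Eq s t) \<longleftrightarrow> Eq (?s s) (Const c) \<in> T"
        using eval_eq[of s e c] e Eq.prems c by simp
      also have "\<dots> \<longleftrightarrow> Eq (?s s) (?s t) \<in> T"
        using c Eq_trans Eq_sym by blast
      finally show "sat M (\<lambda>v. named M (e v)) (Eq s t)
          \<longleftrightarrow> subst (\<lambda>v. Const (e v)) (Eq s t) \<in> T" by simp
    qed
  next
    case (Rel R ts)
    show ?case
      unfolding agrees_def
    proof (intro allI impI)
      fix e :: "nat \<Rightarrow> 'f" assume e: "range e \<subseteq> C"
      let ?s = "substt (\<lambda>v. Const (e v))"
      have ts: "R \<in> rels \<Sigma>" "length ts = rar \<Sigma> R" "\<forall>t\<in>set ts. is_trm \<Sigma> t"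
        using Rel.prems by (auto simp: list_all_iff)
      obtain cs where cs: "length cs = length ts" "set cs \<subseteq> C"
          "\<And>i. i < length ts \<Longrightarrow> Eq (?s (ts ! i)) (Const (cs ! i)) \<in> T"
        using names_list[OF ts(3) e] by blast
      have "map (eval_trm M (\<lambda>v. named M (e v))) ts = map (named M) cs"
      proof (rule nth_equalityI)
        fix i assume "i < length (map (eval_trm M (\<lambda>v. named M (e v))) ts)"
        then have i: "i < length ts" by simp
        then have "cs ! i \<in> C" using cs by (metis nth_mem subsetD)
        then show "map (eval_trm M (\<lambda>v. named M (e v))) ts ! i = map (named M) cs ! i"
          using eval_eq[of "ts ! i" e "cs ! i"] i cs ts(3) e by simp
      qed (use cs in simp)
      then have "sat M (\<lambda>v. named M (e v)) (Rel R ts) \<longleftrightarrow> relI M R (map (named M) cs)"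
        by (simp only: sat.simps)
      also have "\<dots> \<longleftrightarrow> Rel R (map Const cs) \<in> T"
        using rel_flat ts cs by simp
      also have "\<dots> \<longleftrightarrow> Rel R (map ?s ts) \<in> T"
        using Rel_replace[of "map ?s ts" "map Const cs" R] ts cs by simp
      finally show "sat M (\<lambda>v. named M (e v)) (Rel R ts)
          \<longleftrightarrow> subst (\<lambda>v. Const (e v)) (Rel R ts) \<in> T" by simp
    qed
  next
    case (Neg \<phi>)
    then show ?case
      using Neg_mem_iff instance_sentence[of \<phi>] by (simp add: agrees_def)
  next
    case (Conj \<phi> \<psi>)
    then show ?case by (simp add: agrees_def Conj_mem_iff)
  next
    case (Ex x \<phi>)
    show ?case
      unfolding agrees_def
    proof (intro allI impI)
      fix e :: "nat \<Rightarrow> 'f" assume e: "range e \<subseteq> C"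
      let ?\<sigma> = "(\<lambda>v. Const (e v))(x := Var x)"
      have inst: "subst1 x (Const c) (subst ?\<sigma> \<phi>) = subst (\<lambda>v. Const ((e(x := c)) v)) \<phi>" for c
      proof -
        have "subst1 x (Const c) (subst ?\<sigma> \<phi>) = subst (\<lambda>v. substt (Var(x := Const c)) (?\<sigma> v)) \<phi>"
          unfolding subst1_def by (rule subst_subst) auto
        also have "(\<lambda>v. substt (Var(x := Const c)) (?\<sigma> v)) = (\<lambda>v. Const ((e(x := c)) v))" by auto
        finally show ?thesis .
      qed
      have upd: "(\<lambda>v. named M (e v))(x := named M c) = (\<lambda>v. named M ((e(x := c)) v))" for c by auto
      \<comment> \<open>Since every element is named, quantifying over the universe amounts to
        quantifying over \<open>C\<close>.\<close>
      have "sat M (\<lambda>v. named M (e v)) (Ex x \<phi>)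
          \<longleftrightarrow> (\<exists>c\<in>C. sat M (\<lambda>v. named M ((e(x := c)) v)) \<phi>)"
        unfolding sat.simps upd[symmetric] using names named_in_univ[OF struct] by metis
      also have "\<dots> \<longleftrightarrow> (\<exists>c\<in>C. subst1 x (Const c) (subst ?\<sigma> \<phi>) \<in> T)"
        unfolding inst
      proof (rule bex_cong[OF HOL.refl])
        fix c assume "c \<in> C"
        then have "range (e(x := c)) \<subseteq> C" using e by auto
        then show "sat M (\<lambda>v. named M ((e(x := c)) v)) \<phi>
            \<longleftrightarrow> subst (\<lambda>v. Const ((e(x := c)) v)) \<phi> \<in> T"
          using Ex.IH Ex.prems unfolding agrees_def is_fm.simps by blast
      qed
      \<comment> \<open>The Henkin step: the witness property of \<open>T\<close> gives one
        direction, existential introduction the other.\<close>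
      also have "\<dots> \<longleftrightarrow> Ex x (subst ?\<sigma> \<phi>) \<in> T"
      proof
        assume "\<exists>c\<in>C. subst1 x (Const c) (subst ?\<sigma> \<phi>) \<in> T"
        then obtain c where c: "c \<in> C" "subst1 x (Const c) (subst ?\<sigma> \<phi>) \<in> T" by blast
        show "Ex x (subst ?\<sigma> \<phi>) \<in> T"
        proof (rule Ex_memI[OF c(2)])
          show "is_fm \<Sigma>C (subst ?\<sigma> \<phi>)"
            using Ex.prems e is_trm_Const is_fm_add_consts[OF new, of \<phi>]
            by (intro is_fm_subst) auto
          show "fv (subst ?\<sigma> \<phi>) \<subseteq> {x}"
            by (rule fv_subst_subsetI) auto
        qed (auto simp: is_trm_Const c(1) free_for_closed simp del: is_trm.simps)
      qed (elim Ex_memE, blast)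
      finally show "sat M (\<lambda>v. named M (e v)) (Ex x \<phi>)
          \<longleftrightarrow> subst (\<lambda>v. Const (e v)) (Ex x \<phi>) \<in> T" by simp
    qed
  qed
qed

end

theorem theorem5p1:
  fixes \<Sigma> :: "('f, 'r) signature"
    and C :: "'f set"
    and T0 T :: "('f, 'r) fm set"
    and M0 M :: "('f, 'r, 'a) struct"
  assumes "is_theory \<Sigma> T0" and "consistent \<Sigma> T0"
    and "C \<inter> funs \<Sigma> = {}"
    and "complete_theory (add_consts \<Sigma> C) T" and "T0 \<subseteq> T"
    and "has_witnesses C T"
    and "is_model \<Sigma> M0 T0"
    and "is_expansion \<Sigma> M0 (add_consts \<Sigma> C) M"
    and "\<forall>a\<in>univ M. infinite {c \<in> C. named M c = a}"
  shows "(preserving_condition \<Sigma> C T M M \<longleftrightarrow> preserving_condition \<Sigma> C T M (reduct M \<Sigma>))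
    \<and> (preserving_condition \<Sigma> C T M (reduct M \<Sigma>) \<longleftrightarrow> is_canonical_model \<Sigma> C T M)"
proof -
  interpret henkin_theory \<Sigma> C T
    using assms by unfold_locales
  have struct: "is_struct \<Sigma>C M"
    using assms(8) unfolding is_expansion_def by blast
  have names: "\<exists>c\<in>C. named M c = a" if "a \<in> univ M" for a
    using assms(9) that by (metis (mono_tags, lifting) empty_Collect_eq finite.emptyI)
  \<comment> \<open>It suffices to treat \<open>M\<close> itself, because passing to the reduct does
    not change the preserving condition.\<close>
  have "preserving_condition \<Sigma> C T M M \<longleftrightarrow> is_canonical_model \<Sigma> C T M"
  proof
    assume "preserving_condition \<Sigma> C T M M"
    then show "is_canonical_model \<Sigma> C T M"
      using canonical_if_agrees[OF struct] assms(9) agrees_if_preserving by blast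
  next
    assume "is_canonical_model \<Sigma> C T M"
    then show "preserving_condition \<Sigma> C T M M"
      using preserving_if_agrees[OF struct] agrees_if_canonical[OF struct names] by blast
  qed
  then show ?thesis by (simp add: preserving_condition_reduct)
qed

end
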